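(* Let $n\ge 2$, let $N$ be a finite-index normal subgroup of the free group $\mathbf{F}_n$, and let $\Gamma$ be the finite regular cover of the rose $\mathbf{R}_n$ corresponding to $N$. Then the separability complex $\mathrm{SC}(\Gamma)$ is connected if and only if $N$ is generated by $N\cap\mathcal{C}^{\mathrm{sep}}$.
   Context: $\mathbf{F}_n$ is the free group on $X_n=\{x_1,\dots,x_n\}$, and $\mathbf{R}_n$ is the rose (graph with one vertex and $n$ edges), with $\pi_1(\mathbf{R}_n)$ identified with $\mathbf{F}_n$. Finite regular covers $\Gamma\to\mathbf{R}_n$ correspond to finite-index normal subgroups of $\mathbf{F}_n$, and $\pi_1(\Gamma)$ is identified with the corresponding subgroup $N$. A proper free factor of $\mathbf{F}_n$ is a nontrivial proper subgroup $F$ such that $\mathbf{F}_n=F*G$ for some nontrivial proper subgroup $G$. An element of $\mathbf{F}_n$ is separable if it lies in some proper free factor; $\mathcal{C}^{\mathrm{sep}}$ is the set of separable elements. The separability complex $\mathrm{SC}(\Gamma)$ is the directed graph defined as follows. Its vertices are the $\mathbf{F}_n$-conjugacy classes $[v]$ of elements $v\in\pi_1(\Gamma)$. Each edge is labeled by the $\mathbf{F}_n$-conjugacy class $[\alpha]$ of a nontrivial element of $\mathcal{C}^{\mathrm{sep}}\cap\pi_1(\Gamma)$; there is an edge labeled $[\alpha]$ from $[v]$ to $[w]$ whenever there are $\hat\alpha\in[\alpha]$, $\hat v\in[v]$, $\hat w\in[w]$ with $\hat w=\hat v\hat\alpha$ in $\mathbf{F}_n$. *)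

theory Defs
  imports "HOL-Algebra.Generated_Groups" "Graph_Theory.Digraph_Component"
begin

section \<open>Free groups\<close>

text \<open>The letter \<open>(i, True)\<close> stands for \<open>x\<^sub>i\<close> and \<open>(i, False)\<close> for its formal inverse.
  Elements of the free group are the reduced words.\<close>

type_synonym word = "(nat \<times> bool) list"

definition inv_letter :: "nat \<times> bool \<Rightarrow> nat \<times> bool" where
  "inv_letter a = (fst a, \<not> snd a)"

definition reduced :: "word \<Rightarrow> bool" where
  "reduced w \<longleftrightarrow> successively (\<lambda>a b. b \<noteq> inv_letter a) w"

fun push :: "nat \<times> bool \<Rightarrow> word \<Rightarrow> word" where
  "push a [] = [a]"
| "push a (b # w) = (if b = inv_letter a then w else a # b # w)"

definition free_group :: "nat \<Rightarrow> word monoid" where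
  "free_group n =
    \<lparr>carrier = {w. reduced w \<and> fst ` set w \<subseteq> {1..n}},
     monoid.mult = (\<lambda>u v. foldr push u v),
     one = []\<rparr>"

abbreviation gen :: "nat \<Rightarrow> word" where
  "gen i \<equiv> [(i, True)]"

lemma inv_letter_inv_letter [simp]: "inv_letter (inv_letter a) = a"
  by (simp add: inv_letter_def)

lemma inv_letter_neq [simp]: "inv_letter a \<noteq> a" "a \<noteq> inv_letter a"
  by (cases a, simp add: inv_letter_def)+

lemma fst_inv_letter [simp]: "fst (inv_letter a) = fst a"
  by (simp add: inv_letter_def)

lemma reduced_Nil [simp]: "reduced []"
  by (simp add: reduced_def)

lemma reduced_Cons: "reduced (a # w) \<longleftrightarrow> w = [] \<or> (hd w \<noteq> inv_letter a \<and> reduced w)"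
  by (cases w) (auto simp: reduced_def)

lemma reduced_push: "reduced w \<Longrightarrow> reduced (push a w)"
  by (cases w) (auto simp: reduced_Cons)

lemma reduced_foldr_push: "reduced w \<Longrightarrow> reduced (foldr push u w)"
  by (induction u) (auto intro: reduced_push)

lemma push_reduced: "reduced (a # w) \<Longrightarrow> push a w = a # w"
  by (cases w) (auto simp: reduced_Cons)

lemma foldr_push_reduced: "reduced u \<Longrightarrow> foldr push u [] = u"
proof (induction u)
  case (Cons a u)
  then have "reduced u" by (auto simp: reduced_Cons)
  with Cons push_reduced show ?case by simp
qed simp

lemma push_inv_push: "reduced w \<Longrightarrow> push (inv_letter a) (push a w) = w"
proof (cases w)
  case (Cons b v)
  assume "reduced w"
  with Cons have "b = inv_letter a \<Longrightarrow> push (inv_letter a) v = b # v"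
    using push_reduced by blast
  with Cons show ?thesis by auto
qed simp

lemma push_push_inv: "reduced w \<Longrightarrow> push a (push (inv_letter a) w) = w"
  using push_inv_push[of w "inv_letter a"] by simp

lemma foldr_push_push:
  "reduced w \<Longrightarrow> foldr push (push a v) w = push a (foldr push v w)"
  by (cases v) (auto simp: push_push_inv reduced_foldr_push)

lemma foldr_push_assoc:
  "reduced w \<Longrightarrow> foldr push (foldr push u v) w = foldr push u (foldr push v w)"
  by (induction u) (auto simp: foldr_push_push)

lemma foldr_push_inverse:
  "reduced w \<Longrightarrow> foldr push (rev (map inv_letter u)) (foldr push u w) = w"
  by (induction u arbitrary: w) (auto simp: push_inv_push reduced_foldr_push)

lemma letters_push: "fst ` set (push a w) \<subseteq> insert (fst a) (fst ` set w)"
  by (cases w) auto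

lemma letters_foldr_push: "fst ` set (foldr push u w) \<subseteq> fst ` set u \<union> fst ` set w"
proof (induction u)
  case (Cons a u)
  have "fst ` set (foldr push (a # u) w) \<subseteq> insert (fst a) (fst ` set (foldr push u w))"
    using letters_push[of a "foldr push u w"] by simp
  also have "\<dots> \<subseteq> insert (fst a) (fst ` set u \<union> fst ` set w)" using Cons by blast
  finally show ?case by simp
qed simp

lemma letters_closed:
  "fst ` set u \<subseteq> S \<Longrightarrow> fst ` set w \<subseteq> S \<Longrightarrow> fst ` set (foldr push u w) \<subseteq> S"
  by (rule order_trans[OF letters_foldr_push]) simp

lemma reduced_rev_inv: "reduced u \<Longrightarrow> reduced (rev (map inv_letter u))"
  unfolding reduced_def
  by (simp add: successively_map) (metis (mono_tags, lifting) inv_letter_inv_letter successively_mono)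

lemma group_free_group: "group (free_group n)"
proof (rule groupI)
  fix x y assume "x \<in> carrier (free_group n)" "y \<in> carrier (free_group n)"
  then show "x \<otimes>\<^bsub>free_group n\<^esub> y \<in> carrier (free_group n)"
    by (simp add: free_group_def reduced_foldr_push letters_closed)
next
  fix x assume x: "x \<in> carrier (free_group n)"
  have "rev (map inv_letter x) \<otimes>\<^bsub>free_group n\<^esub> x = \<one>\<^bsub>free_group n\<^esub>"
    using foldr_push_inverse[of "[]" x] x foldr_push_reduced[of x]
    by (simp add: free_group_def)
  moreover have "rev (map inv_letter x) \<in> carrier (free_group n)"
    using x by (auto simp: free_group_def reduced_rev_inv)
  ultimately show "\<exists>y\<in>carrier (free_group n). y \<otimes>\<^bsub>free_group n\<^esub> x = \<one>\<^bsub>free_group n\<^esub>"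
    by blast
qed (auto simp: free_group_def foldr_push_assoc)

theorem free_group_universal:
  assumes H: "group H" and f: "\<And>i. i \<in> {1..n} \<Longrightarrow> f i \<in> carrier H"
  shows "\<exists>h \<in> hom (free_group n) H. \<forall>i\<in>{1..n}. h (gen i) = f i"
    and "\<lbrakk>h \<in> hom (free_group n) H; h' \<in> hom (free_group n) H;
      \<forall>i\<in>{1..n}. h (gen i) = h' (gen i); w \<in> carrier (free_group n)\<rbrakk> \<Longrightarrow> h w = h' w"
proof -
  interpret H: group H by fact
  interpret F: group "free_group n" by (rule group_free_group)
  define l where "l = (\<lambda>a. if snd a then f (fst a) else inv\<^bsub>H\<^esub> f (fst a))"
  define h where "h = (\<lambda>w. foldr (\<lambda>a x. l a \<otimes>\<^bsub>H\<^esub> x) w \<one>\<^bsub>H\<^esub>)"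
  have l: "l a \<in> carrier H" "l (inv_letter a) = inv\<^bsub>H\<^esub> l a" if "fst a \<in> {1..n}" for a
    using f[OF that] by (auto simp: l_def inv_letter_def)
  have h: "h w \<in> carrier H" if "fst ` set w \<subseteq> {1..n}" for w
    using that by (induction w) (auto simp: h_def l)
  have p: "h (push a w) = l a \<otimes>\<^bsub>H\<^esub> h w" if "fst a \<in> {1..n}" "fst ` set w \<subseteq> {1..n}" for a w
  proof (cases w)
    case (Cons b v)
    then have "h v \<in> carrier H" using that h by auto
    moreover have "h w = l b \<otimes>\<^bsub>H\<^esub> h v" using Cons by (simp add: h_def)
    ultimately show ?thesis using Cons l[OF that(1)]
      by (auto simp: H.m_assoc[symmetric]) (simp add: h_def)
  qed (simp add: h_def)
  have "h (foldr push u v) = h u \<otimes>\<^bsub>H\<^esub> h v"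
    if "fst ` set u \<subseteq> {1..n}" "fst ` set v \<subseteq> {1..n}" for u v
    using that(1)
  proof (induction u)
    case Nil
    then show ?case using h[OF that(2)] by (simp add: h_def)
  next
    case (Cons a u)
    have "fst ` set (foldr push u v) \<subseteq> {1..n}"
      using letters_closed Cons.prems that(2) by simp
    then have "h (foldr push (a # u) v) = l a \<otimes>\<^bsub>H\<^esub> (h u \<otimes>\<^bsub>H\<^esub> h v)"
      using p Cons by simp
    moreover have "h (a # u) = l a \<otimes>\<^bsub>H\<^esub> h u" by (simp add: h_def)
    ultimately show ?case
      using Cons.prems h[of u] h[OF that(2)] l(1)[of a] by (simp add: H.m_assoc)
  qed
  then have "h \<in> hom (free_group n) H"
    using h by (auto simp: hom_def free_group_def)
  moreover have "h (gen i) = f i" if "i \<in> {1..n}" for i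
    using f[OF that] by (simp add: h_def l_def)
  ultimately show "\<exists>h \<in> hom (free_group n) H. \<forall>i\<in>{1..n}. h (gen i) = f i" by blast
next
  assume hs: "h \<in> hom (free_group n) H" "h' \<in> hom (free_group n) H"
    "\<forall>i\<in>{1..n}. h (gen i) = h' (gen i)" "w \<in> carrier (free_group n)"
  interpret H: group H by fact
  interpret F: group "free_group n" by (rule group_free_group)
  interpret h: group_hom "free_group n" H h by unfold_locales (rule hs)
  interpret h': group_hom "free_group n" H h' by unfold_locales (rule hs)
  have "h [a] = h' [a]" if a: "fst a \<in> {1..n}" for a
  proof (cases "snd a")
    case True
    then have "[a] = gen (fst a)" by (cases a) auto
    with a hs(3) show ?thesis by metis
  next
    case False
    then have "inv_letter a = (fst a, True)" by (cases a) (auto simp: inv_letter_def)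
    then have "[a] = inv\<^bsub>free_group n\<^esub> gen (fst a)"
      using a by (intro F.inv_equality[symmetric]) (auto simp: free_group_def reduced_Cons)
    moreover have "gen (fst a) \<in> carrier (free_group n)"
      using a by (auto simp: free_group_def reduced_Cons)
    ultimately show ?thesis using hs(3) a by (metis h.hom_inv h'.hom_inv)
  qed
  then show "h w = h' w" using hs(4)
  proof (induction w)
    case Nil
    then show ?case using h.hom_one h'.hom_one by (simp add: free_group_def)
  next
    case (Cons a w)
    have a: "[a] \<in> carrier (free_group n)" and w: "w \<in> carrier (free_group n)"
      and eq: "a # w = [a] \<otimes>\<^bsub>free_group n\<^esub> w"
      using Cons.prems(2) by (auto simp: free_group_def reduced_Cons push_reduced)
    have "fst a \<in> {1..n}" using Cons.prems(2) by (auto simp: free_group_def)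
    then have "h [a] = h' [a]" using Cons.prems(1) by blast
    moreover have "h w = h' w" using Cons.IH[OF Cons.prems(1) w] by blast
    ultimately show ?case unfolding eq h.hom_mult[OF a w] h'.hom_mult[OF a w] by simp
  qed
qed


section \<open>Separable elements\<close>

text \<open>Internal free product of two subgroups: they generate, and no nonempty alternating
  product of nontrivial elements is trivial. A nontrivial \<open>x \<in> A \<inter> B\<close> is excluded by the
  alternating list \<open>[x, inv x]\<close>.\<close>

definition internal_free_product :: "('a, 'b) monoid_scheme \<Rightarrow> 'a set \<Rightarrow> 'a set \<Rightarrow> bool" where
  "internal_free_product G A B \<longleftrightarrow>
     subgroup A G \<and> subgroup B G \<and> generate G (A \<union> B) = carrier G \<and>
     (\<forall>xs. xs \<noteq> [] \<and> set xs \<subseteq> (A \<union> B) - {\<one>\<^bsub>G\<^esub>} \<and>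
        successively (\<lambda>x y. (x \<in> A \<and> y \<in> B) \<or> (x \<in> B \<and> y \<in> A)) xs
        \<longrightarrow> foldr (\<lambda>x y. x \<otimes>\<^bsub>G\<^esub> y) xs \<one>\<^bsub>G\<^esub> \<noteq> \<one>\<^bsub>G\<^esub>)"

definition proper_nontrivial_subgroup :: "'a set \<Rightarrow> ('a, 'b) monoid_scheme \<Rightarrow> bool" where
  "proper_nontrivial_subgroup A G \<longleftrightarrow> subgroup A G \<and> A \<noteq> {\<one>\<^bsub>G\<^esub>} \<and> A \<noteq> carrier G"

definition proper_free_factor :: "'a set \<Rightarrow> ('a, 'b) monoid_scheme \<Rightarrow> bool" where
  "proper_free_factor A G \<longleftrightarrow> proper_nontrivial_subgroup A G \<and>
     (\<exists>B. proper_nontrivial_subgroup B G \<and> internal_free_product G A B)"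

definition separable_elements :: "nat \<Rightarrow> word set" where
  "separable_elements n = {x. \<exists>A. proper_free_factor A (free_group n) \<and> x \<in> A}"


section \<open>Covers of the rose\<close>

text \<open>A cover of the rose is a digraph whose arcs are labelled, by \<open>p\<close>, with the petal
  \<open>i \<in> {1..n}\<close> they lie over. \<open>lifts_to \<Gamma> p u w v\<close> says that the edge path \<open>w\<close> in the rose
  has a lift to \<open>\<Gamma>\<close> from \<open>u\<close> to \<open>v\<close>; the letter \<open>(i, False)\<close> traverses an arc backwards.\<close>

fun lifts_to :: "('v, 'e) pre_digraph \<Rightarrow> ('e \<Rightarrow> nat) \<Rightarrow> 'v \<Rightarrow> word \<Rightarrow> 'v \<Rightarrow> bool" where
  "lifts_to \<Gamma> p u [] v \<longleftrightarrow> u \<in> verts \<Gamma> \<and> u = v"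
| "lifts_to \<Gamma> p u ((i, e) # w) v \<longleftrightarrow> (\<exists>a\<in>arcs \<Gamma>. p a = i \<and>
     (if e then tail \<Gamma> a = u \<and> lifts_to \<Gamma> p (head \<Gamma> a) w v
      else head \<Gamma> a = u \<and> lifts_to \<Gamma> p (tail \<Gamma> a) w v))"

text \<open>The fundamental group of \<open>\<Gamma>\<close> at \<open>v\<close>, identified with its (injective) image in the
  fundamental group \<open>free_group n\<close> of the rose.\<close>

definition pi1 :: "nat \<Rightarrow> ('v, 'e) pre_digraph \<Rightarrow> ('e \<Rightarrow> nat) \<Rightarrow> 'v \<Rightarrow> word set" where
  "pi1 n \<Gamma> p v = {w \<in> carrier (free_group n). lifts_to \<Gamma> p v w v}"

text \<open>The cover with fundamental group \<open>N\<close>: its vertices are the cosets of \<open>N\<close>, with \<open>N\<close>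
  itself as base vertex, and the arc \<open>(C, i)\<close> lies over the \<open>i\<close>-th petal, so that the
  covering projection on arcs is \<^const>\<open>snd\<close>.\<close>

definition rose_cover :: "nat \<Rightarrow> word set \<Rightarrow> (word set, word set \<times> nat) pre_digraph" where
  "rose_cover n N =
    \<lparr>verts = rcosets\<^bsub>free_group n\<^esub> N,
     arcs = (rcosets\<^bsub>free_group n\<^esub> N) \<times> {1..n},
     tail = fst,
     head = (\<lambda>(C, i). C #>\<^bsub>free_group n\<^esub> gen i)\<rparr>"

context
  fixes n :: nat and N :: "word set"
  assumes N: "N \<lhd> free_group n"
begin

interpretation F: group "free_group n" by (rule group_free_group)

interpretation N: normal N "free_group n" by (rule N)

lemma gen_closed: "i \<in> {1..n} \<Longrightarrow> gen i \<in> carrier (free_group n)"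
  by (auto simp: free_group_def reduced_Cons)

lemma inv_gen: "i \<in> {1..n} \<Longrightarrow> inv\<^bsub>free_group n\<^esub> gen i = [(i, False)]"
  by (rule F.inv_equality) (auto simp: free_group_def reduced_Cons inv_letter_def)

lemma rcosets_subset: "C \<in> rcosets\<^bsub>free_group n\<^esub> N \<Longrightarrow> C \<subseteq> carrier (free_group n)"
  using F.rcosets_part_G[OF N.is_subgroup] by blast

lemma rcosets_translate:
  assumes "C \<in> rcosets\<^bsub>free_group n\<^esub> N" "x \<in> carrier (free_group n)"
  shows "C #>\<^bsub>free_group n\<^esub> x \<in> rcosets\<^bsub>free_group n\<^esub> N"
proof -
  obtain y where "y \<in> carrier (free_group n)" "C = N #>\<^bsub>free_group n\<^esub> y"
    using assms(1) by (auto simp: RCOSETS_def)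
  then show ?thesis
    using assms(2) N.subset by (auto simp: F.coset_mult_assoc intro!: F.rcosetsI)
qed

lemma wf_rose_cover: "wf_digraph (rose_cover n N)"
  by unfold_locales (auto simp: rose_cover_def rcosets_translate gen_closed)

lemma finite_rose_cover:
  "finite (rcosets\<^bsub>free_group n\<^esub> N) \<Longrightarrow> fin_digraph (rose_cover n N)"
  by (rule wf_digraph.fin_digraphI[OF wf_rose_cover]) (auto simp: rose_cover_def)

lemma head_eq_iff:
  assumes "C \<in> rcosets\<^bsub>free_group n\<^esub> N" "D \<in> rcosets\<^bsub>free_group n\<^esub> N" "i \<in> {1..n}"
  shows "C #>\<^bsub>free_group n\<^esub> gen i = D \<longleftrightarrow> C = D #>\<^bsub>free_group n\<^esub> [(i, False)]"
proof -
  have "[(i, False)] \<in> carrier (free_group n)"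
    using assms(3) by (auto simp: free_group_def reduced_Cons)
  then show ?thesis
    using assms gen_closed[OF assms(3)] inv_gen[OF assms(3)]
      rcosets_subset[OF assms(1)] rcosets_subset[OF assms(2)]
    by (metis F.coset_mult_assoc F.coset_mult_one F.l_inv F.r_inv F.inv_closed)
qed

lemma rose_cover_covering:
  assumes "v \<in> verts (rose_cover n N)" "i \<in> {1..n}"
  shows "\<exists>!a. a \<in> arcs (rose_cover n N) \<and> tail (rose_cover n N) a = v \<and> snd a = i"
    and "\<exists>!a. a \<in> arcs (rose_cover n N) \<and> head (rose_cover n N) a = v \<and> snd a = i"
proof -
  show "\<exists>!a. a \<in> arcs (rose_cover n N) \<and> tail (rose_cover n N) a = v \<and> snd a = i"
    using assms by (auto simp: rose_cover_def)
  have v: "v \<in> rcosets\<^bsub>free_group n\<^esub> N" using assms by (simp add: rose_cover_def)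
  have "[(i, False)] \<in> carrier (free_group n)"
    using assms(2) by (auto simp: free_group_def reduced_Cons)
  then have w: "v #>\<^bsub>free_group n\<^esub> [(i, False)] \<in> rcosets\<^bsub>free_group n\<^esub> N"
    using rcosets_translate v by blast
  have h: "D #>\<^bsub>free_group n\<^esub> gen i = v \<longleftrightarrow> D = v #>\<^bsub>free_group n\<^esub> [(i, False)]"
    if "D \<in> rcosets\<^bsub>free_group n\<^esub> N" for D
    using head_eq_iff[OF that v assms(2)] .
  have "(a \<in> arcs (rose_cover n N) \<and> head (rose_cover n N) a = v \<and> snd a = i)
      \<longleftrightarrow> a = (v #>\<^bsub>free_group n\<^esub> [(i, False)], i)" for a
    unfolding rose_cover_def by (cases a, simp) (metis h w assms(2) atLeastAtMost_iff One_nat_def)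
  then show "\<exists>!a. a \<in> arcs (rose_cover n N) \<and> head (rose_cover n N) a = v \<and> snd a = i"
    by simp
qed

lemma lifts_to_rose_cover:
  assumes "w \<in> carrier (free_group n)" "C \<in> rcosets\<^bsub>free_group n\<^esub> N"
  shows "lifts_to (rose_cover n N) snd C w D \<longleftrightarrow> D = C #>\<^bsub>free_group n\<^esub> w"
  using assms
proof (induction w arbitrary: C)
  case Nil
  have "C #>\<^bsub>free_group n\<^esub> [] = C"
    using F.coset_mult_one[OF rcosets_subset[OF Nil(2)]] by (simp add: free_group_def)
  with Nil show ?case by (auto simp: rose_cover_def)
next
  case (Cons a w)
  obtain i e where a: "a = (i, e)" by (cases a)
  have i: "i \<in> {1..n}" and w: "w \<in> carrier (free_group n)"
    and l: "[a] \<in> carrier (free_group n)" and eq: "a # w = [a] \<otimes>\<^bsub>free_group n\<^esub> w"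
    using Cons.prems(1) a by (auto simp: free_group_def reduced_Cons push_reduced)
  have C: "C #>\<^bsub>free_group n\<^esub> (a # w) = (C #>\<^bsub>free_group n\<^esub> [a]) #>\<^bsub>free_group n\<^esub> w"
    unfolding eq using F.coset_mult_assoc rcosets_subset Cons.prems(2) l w by simp
  have Ca: "C #>\<^bsub>free_group n\<^esub> [a] \<in> rcosets\<^bsub>free_group n\<^esub> N"
    using rcosets_translate Cons.prems(2) l by blast
  have IH: "lifts_to (rose_cover n N) snd (C #>\<^bsub>free_group n\<^esub> [a]) w D
      \<longleftrightarrow> D = C #>\<^bsub>free_group n\<^esub> (a # w)"
    unfolding C by (rule Cons.IH[OF w Ca])
  have "lifts_to (rose_cover n N) snd C (a # w) D
      \<longleftrightarrow> lifts_to (rose_cover n N) snd (C #>\<^bsub>free_group n\<^esub> [a]) w D"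
  proof (cases e)
    case True
    then show ?thesis using a i Cons.prems(2) by (auto simp: rose_cover_def)
  next
    case False
    then show ?thesis
      using a i Cons.prems(2) Ca head_eq_iff[OF _ Cons.prems(2) i]
      by (auto simp: rose_cover_def)
  qed
  with IH show ?case by simp
qed

lemma base_vertex: "N \<in> verts (rose_cover n N)"
  using N.subgroup_in_rcosets[OF F.is_group] by (simp add: rose_cover_def)

lemma connected_rose_cover: "connected (rose_cover n N)"
proof -
  interpret S: pair_wf_digraph "mk_symmetric (rose_cover n N)"
    by (rule wf_digraph.wellformed_mk_symmetric[OF wf_rose_cover])
  have arcs_ends_eq: "arcs_ends (mk_symmetric (rose_cover n N)) = parcs (mk_symmetric (rose_cover n N))"
    by (simp add: arcs_ends_conv)
  have reach: "u \<rightarrow>\<^sup>*\<^bsub>mk_symmetric (rose_cover n N)\<^esub> v"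
    if "lifts_to (rose_cover n N) snd u w v" for u w v
    using that
  proof (induction w arbitrary: u)
    case Nil
    then show ?case by auto
  next
    case (Cons a w)
    obtain i e where a: "a = (i, e)" by (cases a)
    have "\<exists>u'. (u, u') \<in> parcs (mk_symmetric (rose_cover n N))
        \<and> lifts_to (rose_cover n N) snd u' w v"
      using Cons.prems unfolding a parcs_mk_symmetric by (cases e) force+
    then obtain u' where "(u, u') \<in> parcs (mk_symmetric (rose_cover n N))"
      "u' \<rightarrow>\<^sup>*\<^bsub>mk_symmetric (rose_cover n N)\<^esub> v"
      using Cons.IH by blast
    then show ?case using S.adj_reachable_trans arcs_ends_eq by blast
  qed
  have "u \<rightarrow>\<^sup>*\<^bsub>mk_symmetric (rose_cover n N)\<^esub> v"
    if uv: "u \<in> verts (rose_cover n N)" "v \<in> verts (rose_cover n N)" for u v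
  proof -
    obtain x y where x: "x \<in> carrier (free_group n)" "u = N #>\<^bsub>free_group n\<^esub> x"
      and y: "y \<in> carrier (free_group n)" "v = N #>\<^bsub>free_group n\<^esub> y"
      using uv by (auto simp: rose_cover_def RCOSETS_def)
    have "v = u #>\<^bsub>free_group n\<^esub> (inv\<^bsub>free_group n\<^esub> x \<otimes>\<^bsub>free_group n\<^esub> y)"
      using x y N.subset by (simp add: F.coset_mult_assoc F.m_assoc[symmetric])
    moreover have "u \<in> rcosets\<^bsub>free_group n\<^esub> N"
      using uv(1) by (simp add: rose_cover_def)
    ultimately show ?thesis
      using x(1) y(1) by (intro reach) (rule lifts_to_rose_cover[THEN iffD2], auto)
  qed
  then show ?thesis
    using base_vertex by (auto simp: connected_def strongly_connected_def)
qed

text \<open>Independence of the base vertex means that the cover is regular.\<close>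

lemma pi1_rose_cover:
  assumes "v \<in> verts (rose_cover n N)"
  shows "pi1 n (rose_cover n N) snd v = N"
proof -
  have v: "v \<in> rcosets\<^bsub>free_group n\<^esub> N" using assms by (simp add: rose_cover_def)
  then obtain y where y: "y \<in> carrier (free_group n)" "v = N #>\<^bsub>free_group n\<^esub> y"
    by (auto simp: RCOSETS_def)
  have "v = v #>\<^bsub>free_group n\<^esub> w \<longleftrightarrow> w \<in> N" if w: "w \<in> carrier (free_group n)" for w
  proof -
    have "v #>\<^bsub>free_group n\<^esub> w = N #>\<^bsub>free_group n\<^esub> (y \<otimes>\<^bsub>free_group n\<^esub> w)"
      using y w N.subset by (simp add: F.coset_mult_assoc)
    also have "\<dots> = v \<longleftrightarrow> y \<otimes>\<^bsub>free_group n\<^esub> w \<in> v"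
      using y w F.repr_independence[OF _ _ N.is_subgroup] F.rcos_self[OF _ N.is_subgroup]
      by (metis F.m_closed)
    also have "v = y <#\<^bsub>free_group n\<^esub> N"
      using y N.coset_eq by simp
    also have "y \<otimes>\<^bsub>free_group n\<^esub> w \<in> y <#\<^bsub>free_group n\<^esub> N \<longleftrightarrow> w \<in> N"
      using y w N.subset by (auto simp: l_coset_def)
    finally show ?thesis using \<open>v = y <#\<^bsub>free_group n\<^esub> N\<close> by metis
  qed
  then show ?thesis
    using lifts_to_rose_cover[OF _ v] N.subset by (auto simp: pi1_def)
qed

end


section \<open>The separability complex\<close>

definition conj_class :: "('a, 'b) monoid_scheme \<Rightarrow> 'a \<Rightarrow> 'a set" where
  "conj_class G x = {g \<otimes>\<^bsub>G\<^esub> x \<otimes>\<^bsub>G\<^esub> inv\<^bsub>G\<^esub> g | g. g \<in> carrier G}"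

text \<open>An arc is a triple \<open>(V, L, W)\<close> of tail, label and head.\<close>

definition separability_complex ::
  "nat \<Rightarrow> ('v, 'e) pre_digraph \<Rightarrow> ('e \<Rightarrow> nat) \<Rightarrow> 'v
    \<Rightarrow> (word set, word set \<times> word set \<times> word set) pre_digraph" where
  "separability_complex n \<Gamma> p v0 =
    (let F = free_group n;
         V = conj_class F ` pi1 n \<Gamma> p v0;
         L = conj_class F ` (separable_elements n \<inter> pi1 n \<Gamma> p v0 - {\<one>\<^bsub>F\<^esub>})
     in \<lparr>verts = V,
         arcs = {(v, l, w). v \<in> V \<and> l \<in> L \<and> w \<in> V \<and>
           (\<exists>v'\<in>v. \<exists>a'\<in>l. \<exists>w'\<in>w. w' = v' \<otimes>\<^bsub>F\<^esub> a')},
         tail = (\<lambda>(v, l, w). v),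
         head = (\<lambda>(v, l, w). w)\<rparr>)"

end

(* The subgroup K generated by the separable elements of N is normal in the free group, because
   automorphisms preserve separability. Membership in K is therefore constant on conjugacy classes,
   and along an edge the classes of v and of v a lie in K simultaneously; so the component of the
   class of 1 stays inside K, and connectedness forces N = K. Conversely, multiplying v by
   a separable element moves along an edge, so an expression of an element w of N as a product
   of separable elements is a path from the class of 1 to the class of w. *)
theory Submission
  imports Defs
begin

section \<open>Transport of free factors along isomorphisms\<close>

lemma proper_nontrivial_subgroup_iso_image:
  assumes "group G" "group H" "h \<in> iso G H" "proper_nontrivial_subgroup A G"
  shows "proper_nontrivial_subgroup (h ` A) H"
proof -
  interpret h: group_hom G H h
    using assms by (auto simp: group_hom_def group_hom_axioms_def iso_def)
  have bij: "bij_betw h (carrier G) (carrier H)" using assms(3) by (simp add: iso_def)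
  have inj: "inj_on h (carrier G)" and surj: "h ` carrier G = carrier H"
    using bij by (auto simp: bij_betw_def)
  have A: "subgroup A G" "A \<noteq> {\<one>\<^bsub>G\<^esub>}" "A \<noteq> carrier G"
    using assms(4) by (auto simp: proper_nontrivial_subgroup_def)
  then have sub: "A \<subseteq> carrier G" by (simp add: subgroup.subset)
  \<comment> \<open>Injectivity on the carrier separates images of distinct subsets. The trivial
    subgroup stays in the form of an image for this purpose, hence the deletion of
    \<open>image_insert\<close>.\<close>
  have "h ` A \<noteq> h ` {\<one>\<^bsub>G\<^esub>}" "h ` A \<noteq> h ` carrier G"
    using A(2,3) inj_on_image_eq_iff[OF inj sub, of "{\<one>\<^bsub>G\<^esub>}"]
      inj_on_image_eq_iff[OF inj sub, of "carrier G"]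
    by (simp_all del: image_insert)
  then show ?thesis
    using h.subgroup_img_is_subgroup[OF A(1)] surj by (simp add: proper_nontrivial_subgroup_def)
qed

lemma (in group_hom) hom_foldr_mult:
  "set xs \<subseteq> carrier G \<Longrightarrow>
    h (foldr (\<lambda>x y. x \<otimes> y) xs \<one>) = foldr (\<lambda>x y. x \<otimes>\<^bsub>H\<^esub> y) (map h xs) \<one>\<^bsub>H\<^esub>"
proof (induction xs)
  case (Cons x xs)
  have "foldr (\<lambda>x y. x \<otimes> y) xs \<one> \<in> carrier G"
    using Cons.prems by (induction xs) auto
  then show ?case using Cons by simp
qed simp

text \<open>A forbidden relation among the images would pull back along the inverse isomorphism to
  an alternating relation between \<open>A\<close> and \<open>B\<close>.\<close>

lemma internal_free_product_iso_image:
  assumes "group G" "group H" "h \<in> iso G H" "internal_free_product G A B"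
  shows "internal_free_product H (h ` A) (h ` B)"
proof -
  interpret h: group_hom G H h
    using assms by (auto simp: group_hom_def group_hom_axioms_def iso_def)
  define k where "k = inv_into (carrier G) h"
  have "k \<in> iso H G" unfolding k_def by (rule group.iso_set_sym[OF assms(1,3)])
  then interpret k: group_hom H G k
    using assms by (auto simp: group_hom_def group_hom_axioms_def iso_def)
  have bij: "bij_betw h (carrier G) (carrier H)" using assms(3) by (simp add: iso_def)
  have kh: "k (h x) = x" if "x \<in> carrier G" for x
    using that bij by (simp add: k_def bij_betw_def)
  have A: "subgroup A G" and B: "subgroup B G" and gen: "generate G (A \<union> B) = carrier G"
    and free: "\<And>xs. \<lbrakk>xs \<noteq> []; set xs \<subseteq> (A \<union> B) - {\<one>\<^bsub>G\<^esub>};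
        successively (\<lambda>x y. (x \<in> A \<and> y \<in> B) \<or> (x \<in> B \<and> y \<in> A)) xs\<rbrakk>
        \<Longrightarrow> foldr (\<lambda>x y. x \<otimes>\<^bsub>G\<^esub> y) xs \<one>\<^bsub>G\<^esub> \<noteq> \<one>\<^bsub>G\<^esub>"
    using assms(4) unfolding internal_free_product_def by blast+
  have sub: "A \<subseteq> carrier G" "B \<subseteq> carrier G" using A B by (simp_all add: subgroup.subset)
  have kA: "k x \<in> A" if "x \<in> h ` A" for x using that kh sub by auto
  have kB: "k x \<in> B" if "x \<in> h ` B" for x using that kh sub by auto
  have "generate H (h ` A \<union> h ` B) = carrier H"
    using h.generate_img[of "A \<union> B"] sub gen bij by (simp add: image_Un bij_betw_def)
  moreover have "foldr (\<lambda>x y. x \<otimes>\<^bsub>H\<^esub> y) xs \<one>\<^bsub>H\<^esub> \<noteq> \<one>\<^bsub>H\<^esub>"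
    if ne: "xs \<noteq> []" and xs: "set xs \<subseteq> (h ` A \<union> h ` B) - {\<one>\<^bsub>H\<^esub>}"
      and alt: "successively (\<lambda>x y. (x \<in> h ` A \<and> y \<in> h ` B) \<or> (x \<in> h ` B \<and> y \<in> h ` A)) xs" for xs
  proof
    assume "foldr (\<lambda>x y. x \<otimes>\<^bsub>H\<^esub> y) xs \<one>\<^bsub>H\<^esub> = \<one>\<^bsub>H\<^esub>"
    moreover have "set xs \<subseteq> carrier H" using xs h.hom_closed sub by blast
    ultimately have "foldr (\<lambda>x y. x \<otimes>\<^bsub>G\<^esub> y) (map k xs) \<one>\<^bsub>G\<^esub> = \<one>\<^bsub>G\<^esub>"
      using k.hom_foldr_mult[of xs] by simp
    moreover have "set (map k xs) \<subseteq> (A \<union> B) - {\<one>\<^bsub>G\<^esub>}"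
    proof
      fix y assume "y \<in> set (map k xs)"
      then obtain x where x: "x \<in> set xs" "y = k x" by auto
      with xs obtain a where a: "a \<in> A \<union> B" "x = h a" "h a \<noteq> \<one>\<^bsub>H\<^esub>" by auto
      \<comment> \<open>Since \<open>h\<close> sends the identity to the identity,
        \<open>h a\<close> being nontrivial forces \<open>a\<close> to be nontrivial.\<close>
      then have "y = a" using kh sub x by auto
      with a show "y \<in> (A \<union> B) - {\<one>\<^bsub>G\<^esub>}" by auto
    qed
    moreover have "successively (\<lambda>x y. (x \<in> A \<and> y \<in> B) \<or> (x \<in> B \<and> y \<in> A)) (map k xs)"
      unfolding successively_map by (rule successively_mono[OF alt]) (use kA kB in blast)
    ultimately show False using free[of "map k xs"] ne by simp
  qed
  ultimately show ?thesis
    unfolding internal_free_product_def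
    using h.subgroup_img_is_subgroup[OF A] h.subgroup_img_is_subgroup[OF B] by blast
qed

lemma proper_free_factor_iso_image:
  assumes "group G" "group H" "h \<in> iso G H" "proper_free_factor A G"
  shows "proper_free_factor (h ` A) H"
  using assms(4) proper_nontrivial_subgroup_iso_image[OF assms(1-3)]
    internal_free_product_iso_image[OF assms(1-3)]
  unfolding proper_free_factor_def by blast

section \<open>Conjugation and separable elements\<close>

lemma (in group) cancel_inv_left:
  assumes "g \<in> carrier G" "x \<in> carrier G"
  shows "inv g \<otimes> (g \<otimes> x) = x" "g \<otimes> (inv g \<otimes> x) = x"
  using assms by (simp_all add: m_assoc[symmetric])

lemma (in group) conjugation_iso:
  assumes g: "g \<in> carrier G"
  shows "(\<lambda>x. g \<otimes> x \<otimes> inv g) \<in> iso G G"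
proof -
  have "(\<lambda>x. g \<otimes> x \<otimes> inv g) \<in> hom G G"
  proof (rule homI)
    fix x y assume "x \<in> carrier G" "y \<in> carrier G"
    then show "g \<otimes> (x \<otimes> y) \<otimes> inv g = g \<otimes> x \<otimes> inv g \<otimes> (g \<otimes> y \<otimes> inv g)"
      using g by (simp add: m_assoc cancel_inv_left)
  qed (use g in simp)
  moreover have "bij_betw (\<lambda>x. g \<otimes> x \<otimes> inv g) (carrier G) (carrier G)"
    by (rule bij_betw_byWitness[where f' = "\<lambda>x. inv g \<otimes> x \<otimes> g"])
      (use g in \<open>auto simp: m_assoc cancel_inv_left\<close>)
  ultimately show ?thesis by (simp add: iso_def)
qed

text \<open>Conjugation by \<open>g\<close> is an automorphism, so it carries a proper free factor
  containing \<open>x\<close> to one containing the conjugate.\<close>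

lemma separable_elements_conj:
  assumes "x \<in> separable_elements n" "g \<in> carrier (free_group n)"
  shows "g \<otimes>\<^bsub>free_group n\<^esub> x \<otimes>\<^bsub>free_group n\<^esub> inv\<^bsub>free_group n\<^esub> g \<in> separable_elements n"
  using assms proper_free_factor_iso_image[OF group_free_group group_free_group
      group.conjugation_iso[OF group_free_group assms(2)]]
  by (fastforce simp: separable_elements_def)

text \<open>A free factor is a subgroup. This makes the inverse of a generator again an edge
  label.\<close>

lemma separable_elements_inv:
  "x \<in> separable_elements n \<Longrightarrow> inv\<^bsub>free_group n\<^esub> x \<in> separable_elements n"
  unfolding separable_elements_def proper_free_factor_def proper_nontrivial_subgroup_def
  by (auto intro: subgroup.m_inv_closed)

section \<open>Conjugacy classes and normal subgroups\<close>

lemma (in group) conj_class_self: "x \<in> carrier G \<Longrightarrow> x \<in> conj_class G x"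
  unfolding conj_class_def by (rule CollectI, rule exI[of _ \<one>]) simp

text \<open>Conjugating \<open>y\<close> back puts \<open>x\<close> in \<open>K\<close>, and
  normality then gives all conjugates. So a class that meets \<open>K\<close> lies inside
  \<open>K\<close>.\<close>

lemma (in group) conj_class_subset_normal:
  assumes K: "K \<lhd> G" and x: "x \<in> carrier G" and y: "y \<in> conj_class G x" "y \<in> K"
  shows "conj_class G x \<subseteq> K"
proof -
  obtain g where g: "g \<in> carrier G" "y = g \<otimes> x \<otimes> inv g"
    using y(1) by (auto simp: conj_class_def)
  then have "x = inv g \<otimes> y \<otimes> g" using x by (simp add: m_assoc cancel_inv_left)
  then have "x \<in> K" using normal.inv_op_closed1[OF K g(1) y(2)] by simp
  then show ?thesis using normal.inv_op_closed2[OF K] by (auto simp: conj_class_def)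
qed

section \<open>Connectedness of the separability complex\<close>

theorem proposition1p2:
  fixes n :: nat and N :: "word set"
  assumes "n \<ge> 2"
    and "N \<lhd> free_group n"
    and "finite (rcosets\<^bsub>free_group n\<^esub> N)"
  shows "connected (separability_complex n (rose_cover n N) snd N) \<longleftrightarrow>
    generate (free_group n) (N \<inter> separable_elements n) = N"
proof -
  define F where "F = free_group n"
  define S where "S = N \<inter> separable_elements n"
  define K where "K = generate F S"
  define SC where "SC = separability_complex n (rose_cover n N) snd N"
  interpret F: group F unfolding F_def by (rule group_free_group)
  interpret N: normal N F unfolding F_def by (rule assms(2))
  have S: "S \<subseteq> carrier F" using N.subset by (auto simp: S_def)
  have S_inv: "inv\<^bsub>F\<^esub> x \<in> S" if "x \<in> S" for x
    using that separable_elements_inv[of x n] N.m_inv_closed by (auto simp: S_def F_def)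
  \<comment> \<open>\<open>S\<close> is invariant under conjugation, because both \<open>N\<close>
    and the set of separable elements are.\<close>
  have K: "K \<lhd> F" unfolding K_def
    by (rule F.normal_generateI[OF S])
      (auto simp: S_def F_def separable_elements_conj N.inv_op_closed2[unfolded F_def])
  interpret K: normal K F by (rule K)
  have "K \<subseteq> N" unfolding K_def
    by (rule F.generate_subgroup_incl[OF _ N.is_subgroup]) (auto simp: S_def)
  have pi1: "pi1 n (rose_cover n N) snd N = N"
    by (rule pi1_rose_cover[OF assms(2) base_vertex[OF assms(2)]])
  have verts: "verts SC = conj_class F ` N"
    by (simp add: SC_def separability_complex_def Let_def pi1 F_def)
  have arcs: "arcs SC = {(v, l, w). v \<in> conj_class F ` N \<and> l \<in> conj_class F ` (S - {\<one>\<^bsub>F\<^esub>}) \<and>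
      w \<in> conj_class F ` N \<and> (\<exists>v'\<in>v. \<exists>a'\<in>l. \<exists>w'\<in>w. w' = v' \<otimes>\<^bsub>F\<^esub> a')}"
    and ends: "tail SC = (\<lambda>(v, l, w). v)" "head SC = (\<lambda>(v, l, w). w)"
    by (simp_all add: SC_def separability_complex_def Let_def pi1 F_def S_def Int_commute)
  interpret SC: wf_digraph SC by unfold_locales (auto simp: verts arcs ends)
  \<comment> \<open>\<open>connected\<close> means strong connectedness of
    \<open>mk_symmetric SC\<close>: paths may cross edges backwards.\<close>
  interpret M: pair_wf_digraph "mk_symmetric SC" by (rule SC.wellformed_mk_symmetric)
  have "connected SC \<longleftrightarrow> K = N"
  proof
    assume conn: "connected SC"
    \<comment> \<open>An equivalence is proved, since a path may use the edge in either
      direction.\<close>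
    have step: "v \<subseteq> K \<longleftrightarrow> w \<subseteq> K" if "(v, l, w) \<in> arcs SC" for v l w
    proof -
      have mem: "v \<in> conj_class F ` N" "l \<in> conj_class F ` (S - {\<one>\<^bsub>F\<^esub>})" "w \<in> conj_class F ` N"
        and ex: "\<exists>v'\<in>v. \<exists>a'\<in>l. \<exists>w'\<in>w. w' = v' \<otimes>\<^bsub>F\<^esub> a'"
        using that unfolding arcs by simp_all
      obtain x where x: "x \<in> N" "v = conj_class F x" using mem(1) by blast
      obtain a where a: "a \<in> S" "l = conj_class F a" using mem(2) by blast
      obtain y where y: "y \<in> N" "w = conj_class F y" using mem(3) by blast
      obtain v' a' w' where e: "v' \<in> v" "a' \<in> l" "w' \<in> w" "w' = v' \<otimes>\<^bsub>F\<^esub> a'"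
        using ex by blast
      have v: "v \<subseteq> K \<longleftrightarrow> v' \<in> K"
        using x e(1) F.conj_class_subset_normal[OF K, of x v'] by auto
      have w: "w \<subseteq> K \<longleftrightarrow> w' \<in> K"
        using y e(3) F.conj_class_subset_normal[OF K, of y w'] by auto
      have "a \<in> K" using a by (simp add: K_def generate.incl)
      \<comment> \<open>The representative \<open>a'\<close> of the label may differ from
        \<open>a\<close>; normality of \<open>K\<close> covers all of the class.\<close>
      then have a': "a' \<in> K"
        using F.conj_class_subset_normal[OF K _ F.conj_class_self] e(2) a S by auto
      have v': "v' \<in> carrier F" using e(1) x by (auto simp: conj_class_def)
      then have "v' = w' \<otimes>\<^bsub>F\<^esub> inv\<^bsub>F\<^esub> a'" using a' e(4) by (simp add: F.m_assoc)
      then have "v' \<in> K \<longleftrightarrow> w' \<in> K"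
        using a' e(4) by (metis K.m_closed K.m_inv_closed)
      with v w show ?thesis by simp
    qed
    have "N \<subseteq> K"
    proof
      fix w assume w: "w \<in> N"
      \<comment> \<open>The class of the identity is a singleton inside \<open>K\<close>;
        \<open>step\<close> carries this containment along the path to the class of
        \<open>w\<close>.\<close>
      have "conj_class F \<one>\<^bsub>F\<^esub> \<rightarrow>\<^sup>*\<^bsub>mk_symmetric SC\<^esub> conj_class F w"
        using conn w by (auto simp: connected_def strongly_connected_def verts)
      then have "conj_class F w \<subseteq> K"
      proof (induction rule: M.reachable_induct)
        case base
        then show ?case by (auto simp: conj_class_def)
      next
        case (step x y)
        then show ?case
          using \<open>\<And>v l w. (v, l, w) \<in> arcs SC \<Longrightarrow> (v \<subseteq> K) = (w \<subseteq> K)\<close>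
          by (fastforce simp: arcs_ends_conv parcs_mk_symmetric ends)
      qed
      then show "w \<in> K" using F.conj_class_self[of w] w by auto
    qed
    with \<open>K \<subseteq> N\<close> show "K = N" by simp
  next
    assume KN: "K = N"
    have edge: "conj_class F v \<rightarrow>\<^sup>*\<^bsub>mk_symmetric SC\<^esub> conj_class F (v \<otimes>\<^bsub>F\<^esub> a)"
      if v: "v \<in> N" and a: "a \<in> S" for v a
    \<comment> \<open>Labels are nontrivial, so \<open>a = \<one>\<close> gives no edge; the path of
      length zero serves instead.\<close>
    proof (cases "a = \<one>\<^bsub>F\<^esub>")
      case True
      then show ?thesis using v by (auto simp: verts)
    next
      case False
      have "a \<in> N" using a by (simp add: S_def)
      then have va: "v \<otimes>\<^bsub>F\<^esub> a \<in> N" using v by simp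
      have "(conj_class F v, conj_class F a, conj_class F (v \<otimes>\<^bsub>F\<^esub> a)) \<in> arcs SC"
        using v a va False F.conj_class_self[of v] F.conj_class_self[of a]
          F.conj_class_self[of "v \<otimes>\<^bsub>F\<^esub> a"] \<open>a \<in> N\<close> N.mem_carrier
        unfolding arcs by blast
      then have "conj_class F v \<rightarrow>\<^bsub>SC\<^esub> conj_class F (v \<otimes>\<^bsub>F\<^esub> a)"
        by (force simp: arcs_ends_conv ends)
      then show ?thesis by (intro SC.reachable_mk_symmetricI) simp
    qed
    \<comment> \<open>The starting point \<open>v\<close> is quantified for the sake of products:
      the path for the second factor \<open>b\<close> starts at the class of
      \<open>v \<otimes> a\<close>.\<close>
    have reach: "\<forall>v\<in>N. conj_class F v \<rightarrow>\<^sup>*\<^bsub>mk_symmetric SC\<^esub> conj_class F (v \<otimes>\<^bsub>F\<^esub> w)"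
      if "w \<in> generate F S" for w
      using that
    proof (induction rule: generate.induct)
      case one
      then show ?case by (auto simp: verts)
    next
      case (incl a)
      then show ?case using edge by blast
    next
      case (inv a)
      \<comment> \<open>The inverse of a generator lies in \<open>S\<close>, so multiplying by it is
        covered by \<open>edge\<close> as well.\<close>
      then show ?case using edge S_inv by blast
    next
      case (eng a b)
      then have ab: "a \<in> N" "b \<in> N" using KN K_def by auto
      show ?case
      proof
        fix v assume v: "v \<in> N"
        have "conj_class F v \<rightarrow>\<^sup>*\<^bsub>mk_symmetric SC\<^esub> conj_class F (v \<otimes>\<^bsub>F\<^esub> a)"
          using eng.IH(1) v by blast
        also have "\<dots> \<rightarrow>\<^sup>*\<^bsub>mk_symmetric SC\<^esub> conj_class F ((v \<otimes>\<^bsub>F\<^esub> a) \<otimes>\<^bsub>F\<^esub> b)"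
          using eng.IH(2) v ab by blast
        finally show "conj_class F v \<rightarrow>\<^sup>*\<^bsub>mk_symmetric SC\<^esub> conj_class F (v \<otimes>\<^bsub>F\<^esub> (a \<otimes>\<^bsub>F\<^esub> b))"
          using v ab by (simp add: F.m_assoc)
      qed
    qed
    have "conj_class F v \<rightarrow>\<^sup>*\<^bsub>mk_symmetric SC\<^esub> conj_class F w" if v: "v \<in> N" and w: "w \<in> N" for v w
    proof -
      \<comment> \<open>The element that carries \<open>v\<close> to \<open>w\<close> by right
        multiplication lies in \<open>N = K\<close>, so \<open>reach\<close> applies to it.\<close>
      have "inv\<^bsub>F\<^esub> v \<otimes>\<^bsub>F\<^esub> w \<in> generate F S" using v w KN K_def by simp
      from reach[OF this] v have
        "conj_class F v \<rightarrow>\<^sup>*\<^bsub>mk_symmetric SC\<^esub> conj_class F (v \<otimes>\<^bsub>F\<^esub> (inv\<^bsub>F\<^esub> v \<otimes>\<^bsub>F\<^esub> w))"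
        by blast
      then show ?thesis using v w by (simp add: F.m_assoc[symmetric])
    qed
    \<comment> \<open>Strong connectedness includes that the vertex set is nonempty.\<close>
    moreover have "N \<noteq> {}" using N.one_closed by blast
    ultimately show "connected SC" by (auto simp: connected_def strongly_connected_def verts)
  qed
  then show ?thesis by (simp add: SC_def K_def S_def F_def)
qed

end
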